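(* For a Tychonoff space $X$, the following assertions are equivalent: (i) $X$ is a $\kappa$-sequential space; (ii) the natural inclusion map $I:\bigoplus\mathcal{S}(X)\to X$ is a weakly $\kappa$-pseudo open map; (iii) $X$ is the image of some metrizable locally compact space under a weakly $\kappa$-pseudo open map; (iv) $X$ is the image of some sequential space under a weakly $\kappa$-pseudo open map; (v) $X$ is the image of some $s_{\mathbb{R}}$-space under a weakly $\kappa$-pseudo open map.
   Context: All topological spaces are assumed to be Tychonoff. $\mathcal{S}(X)$ is the family of all convergent sequences in $X$ with their limit points, i.e. all subspaces $S=\{x_n\}_{n\in\omega}\cup\{x\}$ of $X$ with $x_n\to x$ (constant sequences allowed); $\bigoplus\mathcal{S}(X)=\bigoplus_{S\in\mathcal{S}(X)}S$ is their topological sum (disjoint union), and $I$ is the map whose restriction to each summand $S$ is the inclusion $S\hookrightarrow X$. A space $X$ is $\kappa$-sequential if for every non-closed open $W\subseteq X$ there are a point $z\in\overline{W}\setminus W$ and a sequence $\{x_n\}_{n\in\omega}\subseteq W$ converging to $z$. A surjective continuous map $f:X\to Y$ is called weakly $\kappa$-pseudo open if an open set $U\subseteq Y$ is closed in $Y$ if and only if $f^{-1}(U)$ is closed in $X$. A space $X$ is sequential if for each non-closed $A\subseteq X$ there is a sequence in $A$ converging to some point of $\overline{A}\setminus A$; it is an $s_{\mathbb{R}}$-space if every sequentially continuous function $f:X\to\mathbb{R}$ (i.e. one whose restriction to each convergent sequence together with its limit is continuous) is continuous. *)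

theory Defs
  imports "HOL-Analysis.Analysis"
begin

definition tychonoff_space :: "'a topology \<Rightarrow> bool" where
  "tychonoff_space X \<longleftrightarrow> completely_regular_space X \<and> Hausdorff_space X"

(* A convergent sequence with its limit is represented by its underlying set of points;
   constant sequences give the singletons.  limitin only concerns the tail of s, so
   "range s \<subseteq> topspace X" has to be required separately. *)
definition convergent_seqs :: "'a topology \<Rightarrow> 'a set set" where
  "convergent_seqs X =
     {insert x (range s) | (s :: nat \<Rightarrow> 'a) x.
        range s \<subseteq> topspace X \<and> limitin X s x sequentially}"

(* sum_topology has the pairs (S, x) with x in S as points, so the natural map to X is snd. *)
definition convergent_seqs_sum :: "'a topology \<Rightarrow> ('a set \<times> 'a) topology" where
  "convergent_seqs_sum X = sum_topology (\<lambda>S. subtopology X S) (convergent_seqs X)"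

definition kappa_sequential_space :: "'a topology \<Rightarrow> bool" where
  "kappa_sequential_space X \<longleftrightarrow>
     (\<forall>W. openin X W \<and> \<not> closedin X W \<longrightarrow>
        (\<exists>z \<in> X closure_of W - W. \<exists>s :: nat \<Rightarrow> 'a.
           range s \<subseteq> W \<and> limitin X s z sequentially))"

definition weakly_kappa_pseudo_open_map ::
    "'a topology \<Rightarrow> 'b topology \<Rightarrow> ('a \<Rightarrow> 'b) \<Rightarrow> bool" where
  "weakly_kappa_pseudo_open_map X Y f \<longleftrightarrow>
     continuous_map X Y f \<and> f ` topspace X = topspace Y \<and>
     (\<forall>U. openin Y U \<longrightarrow>
        (closedin Y U \<longleftrightarrow> closedin X {x \<in> topspace X. f x \<in> U}))"

definition sequential_space :: "'a topology \<Rightarrow> bool" where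
  "sequential_space X \<longleftrightarrow>
     (\<forall>A. A \<subseteq> topspace X \<and> \<not> closedin X A \<longrightarrow>
        (\<exists>z \<in> X closure_of A - A. \<exists>s :: nat \<Rightarrow> 'a.
           range s \<subseteq> A \<and> limitin X s z sequentially))"

definition sequentially_continuous_real :: "'a topology \<Rightarrow> ('a \<Rightarrow> real) \<Rightarrow> bool" where
  "sequentially_continuous_real X f \<longleftrightarrow>
     (\<forall>S \<in> convergent_seqs X. continuous_map (subtopology X S) euclideanreal f)"

definition sR_space :: "'a topology \<Rightarrow> bool" where
  "sR_space X \<longleftrightarrow>
     (\<forall>f. sequentially_continuous_real X f \<longrightarrow> continuous_map X euclideanreal f)"

end

theory Submission
  imports Defs
begin

text \<open>A convergent sequence embeds into the real line, so the sum of all of them is metrizable and locally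
  compact, hence sequential and an s_R-space. For (v) \<open>\<Rightarrow>\<close> (i), a non-closed open set \<open>W\<close> that no
  sequence leaves would have a preimage with sequentially continuous, hence continuous, indicator
  function; this preimage would be closed, and so would be \<open>W\<close>.\<close>

section \<open>Metrizability of topological sums\<close>

text \<open>Cut off the metric of each summand at 1 and put points of different summands at distance
  1. A ball of radius at most 1 then stays inside one summand and is a ball of the original metric
  there, so openness can be checked slice by slice, exactly as in the sum topology.\<close>

lemma metrizable_space_sum_topology:
  assumes "\<And>i. i \<in> I \<Longrightarrow> metrizable_space (X i)"
  shows "metrizable_space (sum_topology X I)"
proof -
  have "\<forall>i. \<exists>d. i \<in> I \<longrightarrow>
      Metric_space (topspace (X i)) d \<and> X i = Metric_space.mtopology (topspace (X i)) d"
    using assms unfolding metrizable_space_def by (metis Metric_space.topspace_mtopology)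
  then obtain d where d: "\<And>i. i \<in> I \<Longrightarrow> Metric_space (topspace (X i)) (d i)"
    and Xd: "\<And>i. i \<in> I \<Longrightarrow> X i = Metric_space.mtopology (topspace (X i)) (d i)"
    by metis
  define M where "M = Sigma I (topspace \<circ> X)"
  \<comment> \<open>\<open>Metric_space\<close> demands nonnegativity and symmetry at all pairs,
    even outside the carrier, and \<open>d i\<close> is known to be a metric only for
    \<open>i \<in> I\<close>; hence the test \<open>fst p \<in> I\<close>.\<close>
  define D where "D = (\<lambda>p q. if fst p = fst q \<and> fst p \<in> I then min 1 (d (fst p) (snd p) (snd q)) else 1)"
  have nn: "d i x y \<ge> 0" if "i \<in> I" for i x y
    using Metric_space.nonneg[OF d[OF that]] .
  have zero: "d i x y = 0 \<longleftrightarrow> x = y" if "i \<in> I" "x \<in> topspace (X i)" "y \<in> topspace (X i)" for i x y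
    using Metric_space.zero[OF d[OF that(1)]] that by blast
  have comm: "d i x y = d i y x" if "i \<in> I" for i x y
    using Metric_space.commute[OF d[OF that]] .
  have tri: "d i x z \<le> d i x y + d i y z"
    if "i \<in> I" "x \<in> topspace (X i)" "y \<in> topspace (X i)" "z \<in> topspace (X i)" for i x y z
    using Metric_space.triangle[OF d[OF that(1)]] that by blast
  have MS: "Metric_space M D"
  proof
    show "0 \<le> D p q" for p q
      using nn by (auto simp: D_def)
    show "D p q = D q p" for p q
      using comm by (auto simp: D_def)
    show "D p q = 0 \<longleftrightarrow> p = q" if "p \<in> M" "q \<in> M" for p q
    proof (cases p; cases q)
      fix i x j y
      assume "p = (i, x)" "q = (j, y)"
      then show ?thesis
        using that zero[of i x y] by (auto simp: D_def M_def min_def)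
    qed
    show "D p r \<le> D p q + D q r" if "p \<in> M" "q \<in> M" "r \<in> M" for p q r
    proof (cases "fst p = fst q \<and> fst q = fst r")
      case True
      then have "d (fst p) (snd p) (snd r) \<le> d (fst p) (snd p) (snd q) + d (fst p) (snd q) (snd r)"
        using that by (intro tri) (auto simp: M_def)
      moreover have "fst p \<in> I"
        using that by (auto simp: M_def)
      ultimately show ?thesis
        using True nn[of "fst p" "snd p" "snd q"] nn[of "fst p" "snd q" "snd r"]
          nn[of "fst p" "snd p" "snd r"]
        by (auto simp: D_def min_def)
    next
      \<comment> \<open>One of the two steps from \<open>p\<close> over \<open>q\<close> to
        \<open>r\<close> changes the summand and so has length 1, while \<open>D p r\<close> never
        exceeds 1.\<close>
      case False
      then show ?thesis
        using nn by (auto simp: D_def)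
    qed
  qed
  interpret S: Metric_space M D
    by (rule MS)
  have ball: "S.mball (i, x) r = Pair i ` Metric_space.mball (topspace (X i)) (d i) x r"
    if "i \<in> I" "r \<le> 1" for i x r
  proof -
    have "(j, y) \<in> S.mball (i, x) r \<longleftrightarrow> j = i \<and> y \<in> Metric_space.mball (topspace (X i)) (d i) x r" for j y
      using that unfolding S.in_mball Metric_space.in_mball[OF d[OF that(1)]]
      by (auto simp: M_def D_def min_def)
    then show ?thesis
      by (auto simp: image_iff)
  qed
  have mono: "Pair i ` Metric_space.mball (topspace (X i)) (d i) x r \<subseteq> U \<longleftrightarrow>
      Metric_space.mball (topspace (X i)) (d i) x r \<subseteq> {y. (i, y) \<in> U}" for i x r U
    by blast
  \<comment> \<open>Any radius may be shrunk to \<open>min 1 r\<close>, where \<open>ball\<close>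
    applies; so the two metrics give the same neighbourhoods on a slice.\<close>
  have small: "(\<exists>r>0. S.mball (i, x) r \<subseteq> U) \<longleftrightarrow>
      (\<exists>r>0. Metric_space.mball (topspace (X i)) (d i) x r \<subseteq> {y. (i, y) \<in> U})"
    (is "?l \<longleftrightarrow> ?r") if i: "i \<in> I" for i x U
  proof
    assume ?l
    then obtain r where "r > 0" "S.mball (i, x) r \<subseteq> U"
      by blast
    then have "min 1 r > 0" "S.mball (i, x) (min 1 r) \<subseteq> U"
      using S.mball_subset_concentric[of "min 1 r" r "(i, x)"] by auto
    then show ?r
      using ball[OF i, of "min 1 r" x] mono by fastforce
  next
    assume ?r
    then obtain r where "r > 0" "Metric_space.mball (topspace (X i)) (d i) x r \<subseteq> {y. (i, y) \<in> U}"
      by blast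
    then have "min 1 r > 0" "Metric_space.mball (topspace (X i)) (d i) x (min 1 r) \<subseteq> {y. (i, y) \<in> U}"
      using Metric_space.mball_subset_concentric[OF d[OF i], of "min 1 r" r x] by auto
    then show ?l
      using ball[OF i, of "min 1 r" x] mono by (metis min.cobounded1)
  qed
  have open_X: "openin (X i) V \<longleftrightarrow> V \<subseteq> topspace (X i) \<and>
      (\<forall>x. x \<in> V \<longrightarrow> (\<exists>r>0. Metric_space.mball (topspace (X i)) (d i) x r \<subseteq> V))"
    if "i \<in> I" for i V
    using Metric_space.openin_mtopology[OF d[OF that]] Xd[OF that] by metis
  have "openin (sum_topology X I) U \<longleftrightarrow> openin S.mtopology U" for U
  proof
    assume U: "openin (sum_topology X I) U"
    then have UM: "U \<subseteq> M" and slice: "\<And>i. i \<in> I \<Longrightarrow> openin (X i) {y. (i, y) \<in> U}"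
      by (auto simp: openin_sum_topology M_def)
    have "\<exists>r>0. S.mball (i, x) r \<subseteq> U" if "(i, x) \<in> U" for i x
    proof -
      have "i \<in> I"
        using that UM by (auto simp: M_def)
      with slice have "openin (X i) {y. (i, y) \<in> U}"
        by blast
      with that show ?thesis
        unfolding small[OF \<open>i \<in> I\<close>] open_X[OF \<open>i \<in> I\<close>] by simp
    qed
    then show "openin S.mtopology U"
      using UM by (auto simp: S.openin_mtopology)
  next
    assume U: "openin S.mtopology U"
    then have UM: "U \<subseteq> M" and balls: "\<And>p. p \<in> U \<Longrightarrow> \<exists>r>0. S.mball p r \<subseteq> U"
      by (auto simp: S.openin_mtopology)
    have "openin (X i) {y. (i, y) \<in> U}" if i: "i \<in> I" for i
    proof -
      have "{y. (i, y) \<in> U} \<subseteq> topspace (X i)"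
        using UM by (auto simp: M_def)
      then show ?thesis
        unfolding open_X[OF i] small[OF i, symmetric] using balls by simp
    qed
    then show "openin (sum_topology X I) U"
      using UM by (simp add: openin_sum_topology M_def)
  qed
  then have "sum_topology X I = S.mtopology"
    by (simp add: topology_eq)
  then show ?thesis
    using S.metrizable_space_mtopology by simp
qed

section \<open>Convergent sequences as subspaces\<close>

text \<open>Finite sets are closed, which settles a set containing the limit. Every other point is
  isolated: a neighbourhood disjoint from one of the limit meets only finitely many terms. Hence a
  set without the limit is a union of open singletons.\<close>

lemma openin_convergent_seq:
  assumes X: "Hausdorff_space X" and s: "range s \<subseteq> topspace X" "limitin X s x sequentially"
    and A: "A \<subseteq> insert x (range s)" "x \<in> A \<Longrightarrow> finite (insert x (range s) - A)"
  shows "openin (subtopology X (insert x (range s))) A"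
proof -
  let ?S = "insert x (range s)"
  have x: "x \<in> topspace X"
    using s(2) by (simp add: limitin_def)
  have top: "topspace (subtopology X ?S) = ?S"
    using s(1) x by auto
  have fin: "closedin (subtopology X ?S) F" if "finite F" "F \<subseteq> ?S" for F
    using that top X
    by (metis Hausdorff_imp_t1_space Hausdorff_space_subtopology t1_space_closedin_finite)
  show ?thesis
  proof (cases "x \<in> A")
    case True
    then have "closedin (subtopology X ?S) (?S - A)"
      using fin[of "?S - A"] A(2) by auto
    then show ?thesis
      using A(1) top by (metis double_diff order_refl openin_closedin)
  next
    case False
    have "openin (subtopology X ?S) {y}" if "y \<in> A" for y
    proof -
      have "y \<noteq> x" "y \<in> ?S" "y \<in> topspace X"
        using that False A(1) s(1) x by auto
      then obtain U V where UV: "openin X U" "openin X V" "y \<in> U" "x \<in> V" "disjnt U V"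
        using X x unfolding Hausdorff_space_def by metis
      then obtain N where "\<And>n. N \<le> n \<Longrightarrow> s n \<in> V"
        using s(2) unfolding limitin_sequentially by blast
      then have "U \<inter> ?S \<subseteq> s ` {..<N}"
        using UV(4,5) by (auto simp: disjnt_iff) (meson imageI lessThan_iff not_le)
      \<comment> \<open>Deleting the finitely many other points, a closed set, from the open set
        \<open>U \<inter> ?S\<close> leaves just \<open>{y}\<close>.\<close>
      then have "finite (U \<inter> ?S - {y})"
        by (meson finite_Diff finite_imageI finite_lessThan finite_subset)
      then have "closedin (subtopology X ?S) (U \<inter> ?S - {y})"
        by (intro fin) auto
      moreover have "openin (subtopology X ?S) (U \<inter> ?S)"
        using UV(1) by (simp add: openin_subtopology_Int)
      ultimately have "openin (subtopology X ?S) (U \<inter> ?S - (U \<inter> ?S - {y}))"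
        by (rule openin_diff[rotated])
      moreover have "U \<inter> ?S - (U \<inter> ?S - {y}) = {y}"
        using UV(3) \<open>y \<in> ?S\<close> by blast
      ultimately show ?thesis
        by simp
    qed
    then show ?thesis
      using openin_Union[of "(\<lambda>y. {y}) ` A" "subtopology X ?S"] by auto
  qed
qed

lemma compact_space_convergent_seq:
  assumes "S \<in> convergent_seqs X"
  shows "compact_space (subtopology X S)"
proof -
  obtain s x where s: "range s \<subseteq> topspace X" "limitin X s x sequentially" "S = insert x (range s)"
    using assms unfolding convergent_seqs_def by blast
  have "compactin X S"
    unfolding s(3) by (rule compactin_sequence_with_limit[OF s(2) order_refl s(1)])
  then show ?thesis
    by (rule compact_space_subtopology)
qed

text \<open>Sending the limit to \<open>0\<close> and any other point \<open>y\<close> to \<open>1 / (n + 1)\<close>, with \<open>n\<close> the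
  first index of \<open>y\<close>, embeds a convergent sequence into the real line, whether or not the
  sequence takes infinitely many values.\<close>

lemma metrizable_space_convergent_seq:
  assumes X: "Hausdorff_space X" and S: "S \<in> convergent_seqs X"
  shows "metrizable_space (subtopology X S)"
proof -
  obtain s x where s: "range s \<subseteq> topspace X" "limitin X s x sequentially"
    and S_eq: "S = insert x (range s)"
    using S unfolding convergent_seqs_def by blast
  have sub: "S \<subseteq> topspace X"
    using s by (auto simp: S_eq limitin_def)
  define g where "g = (\<lambda>y. if y = x then 0 else 1 / (real (LEAST n. s n = y) + 1))"
  have s_Least: "s (LEAST n. s n = y) = y" if "y \<in> S" "y \<noteq> x" for y
    using that LeastI_ex[of "\<lambda>n. s n = y"] by (auto simp: S_eq)
  \<comment> \<open>The limit is the only point with value 0, and \<open>s\<close> recovers any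
    other point from its first index.\<close>
  have "inj_on g S"
  proof (rule inj_onI)
    fix y z
    assume yz: "y \<in> S" "z \<in> S" "g y = g z"
    show "y = z"
    proof (cases "y = x \<or> z = x")
      case True
      then show ?thesis
        using yz(3) by (auto simp: g_def split: if_splits)
    next
      case False
      then have "(LEAST n. s n = y) = (LEAST n. s n = z)"
        using yz(3) by (simp add: g_def)
      then show ?thesis
        using s_Least False yz by metis
    qed
  qed
  moreover have "continuous_map (subtopology X S) euclideanreal g"
    unfolding continuous_map_def
  proof (intro conjI allI impI)
    fix V :: "real set"
    assume "openin euclideanreal V"
    then have V: "open V"
      by simp
    \<comment> \<open>By \<open>openin_convergent_seq\<close> only a preimage containing the limit
      needs an argument. Then \<open>0 \<in> V\<close>, and all points with first index at least
      \<open>N\<close> are sent into \<open>V\<close>, so at most the first \<open>N\<close> terms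
      are missed.\<close>
    have "finite (S - {y \<in> S. g y \<in> V})" if "x \<in> {y \<in> S. g y \<in> V}"
    proof -
      have "0 \<in> V"
        using that by (simp add: g_def)
      then obtain e where e: "e > 0" "\<And>r. \<bar>r\<bar> < e \<Longrightarrow> r \<in> V"
        using V unfolding open_dist by (metis dist_real_def diff_zero)
      obtain N where N: "1 / (real N + 1) < e"
        using e(1) reals_Archimedean by (metis Suc_eq_plus1 inverse_eq_divide of_nat_Suc add.commute)
      have "y \<in> s ` {..<N}" if y: "y \<in> S" "g y \<notin> V" for y
      proof -
        have "y \<noteq> x"
          using y \<open>0 \<in> V\<close> by (auto simp: g_def)
        have "\<not> N \<le> (LEAST n. s n = y)"
        proof
          assume "N \<le> (LEAST n. s n = y)"
          then have "g y \<le> 1 / (real N + 1)" "0 \<le> g y"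
            using \<open>y \<noteq> x\<close> by (auto simp: g_def intro!: divide_left_mono)
          then show False
            using N e(2) y(2) by force
        qed
        then show ?thesis
          using s_Least[OF y(1) \<open>y \<noteq> x\<close>] by (metis image_eqI lessThan_iff not_le)
      qed
      then have "S - {y \<in> S. g y \<in> V} \<subseteq> s ` {..<N}"
        by blast
      then show ?thesis
        by (rule finite_subset) simp
    qed
    then have "openin (subtopology X S) {y \<in> S. g y \<in> V}"
      unfolding S_eq by (intro openin_convergent_seq[OF X s]) auto
    then show "openin (subtopology X S) {y \<in> topspace (subtopology X S). g y \<in> V}"
      using sub by (simp add: Int_absorb1)
  qed simp
  \<comment> \<open>A continuous injection of a compact space into a Hausdorff space is an
    embedding.\<close>
  ultimately have "embedding_map (subtopology X S) euclideanreal g"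
    using sub compact_space_convergent_seq[OF S]
    by (intro continuous_imp_embedding_map) (auto simp: Int_absorb1)
  then show ?thesis
    using embedding_map_imp_homeomorphic_space homeomorphic_metrizable_space
      metrizable_space_euclidean metrizable_space_subtopology by blast
qed

section \<open>Sequential spaces and s_R-spaces\<close>

lemma limitin_sequentially_closure_of:
  assumes "limitin X s l sequentially" "range s \<subseteq> A"
  shows "l \<in> X closure_of A"
  unfolding in_closure_of
proof (intro conjI allI impI)
  show "l \<in> topspace X"
    using assms(1) by (simp add: limitin_def)
  fix T
  assume "l \<in> T \<and> openin X T"
  then obtain N where "\<And>n. N \<le> n \<Longrightarrow> s n \<in> T"
    using assms(1) unfolding limitin_sequentially by blast
  then have "s N \<in> T"
    by simp
  then show "\<exists>y. y \<in> A \<and> y \<in> T"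
    using assms(2) by blast
qed

lemma metrizable_imp_sequential_space:
  assumes "metrizable_space X"
  shows "sequential_space X"
proof -
  obtain M d where "Metric_space M d" and X: "X = Metric_space.mtopology M d"
    using assms metrizable_space_def by blast
  then interpret Metric_space M d
    by simp
  show ?thesis
    unfolding sequential_space_def
  proof (intro allI impI)
    fix A
    assume A: "A \<subseteq> topspace X \<and> \<not> closedin X A"
    then obtain \<sigma> l where \<sigma>: "range \<sigma> \<subseteq> A" "limitin X \<sigma> l sequentially" "l \<notin> A"
      using metric_closedin_iff_sequentially_closed X by auto
    have "l \<in> X closure_of A"
      using \<sigma> A by (blast intro: limitin_sequentially_closure_of)
    with \<sigma> show "\<exists>z\<in>X closure_of A - A. \<exists>s. range s \<subseteq> A \<and> limitin X s z sequentially"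
      by blast
  qed
qed

lemma metrizable_imp_tychonoff_space:
  "metrizable_space X \<Longrightarrow> tychonoff_space X"
  by (simp add: tychonoff_space_def metrizable_imp_completely_regular_space
      metrizable_imp_Hausdorff_space)

text \<open>If the preimage of a closed set \<open>C\<close> were not closed, some sequence in it
  would converge to a point \<open>z\<close> outside it; continuity of \<open>f\<close> on this one
  convergent sequence already forces \<open>f z \<in> C\<close>.\<close>

lemma sequential_imp_sR_space:
  assumes "sequential_space X"
  shows "sR_space X"
  unfolding sR_space_def
proof (intro allI impI)
  fix f
  assume f: "sequentially_continuous_real X f"
  have "closedin X {y \<in> topspace X. f y \<in> C}" if C: "closed C" for C
  proof (rule ccontr)
    let ?A = "{y \<in> topspace X. f y \<in> C}"
    assume "\<not> closedin X ?A"
    then obtain z s where z: "z \<in> X closure_of ?A" "z \<notin> ?A" and s: "range s \<subseteq> ?A" "limitin X s z sequentially"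
      using assms unfolding sequential_space_def by (metis (no_types, lifting) Diff_iff mem_Collect_eq subsetI)
    let ?S = "insert z (range s)"
    have "?S \<in> convergent_seqs X"
      using s unfolding convergent_seqs_def by blast
    then have "continuous_map (subtopology X ?S) euclideanreal f"
      using f unfolding sequentially_continuous_real_def by blast
    moreover have "limitin (subtopology X ?S) s z sequentially"
      using s by (simp add: limitin_subtopology)
    ultimately have "(f \<circ> s) \<longlonglongrightarrow> f z"
      using continuous_map_limit by fastforce
    then have "f z \<in> C"
      using closed_sequentially[OF C, of "f \<circ> s"] s(1) by (auto simp: image_subset_iff)
    then show False
      using z s(2) by (simp add: limitin_def)
  qed
  then show "continuous_map X euclideanreal f"
    by (simp add: continuous_map_closedin)
qed

section \<open>Images of s_R-spaces\<close>

text \<open>\<open>A\<close> need not lie in the space: the indicator of one fixed set is to be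
  restricted to many subspaces, on each of which only the trace of \<open>A\<close> is
  clopen.\<close>

lemma continuous_map_indicator_clopen:
  assumes "openin X {x \<in> topspace X. x \<in> A}" "closedin X {x \<in> topspace X. x \<in> A}"
  shows "continuous_map X euclideanreal (indicator A)"
  unfolding continuous_map_def
proof (intro conjI allI impI)
  fix V :: "real set"
  let ?A = "{x \<in> topspace X. x \<in> A}"
  have "{x \<in> topspace X. indicator A x \<in> V} =
      (if 1 \<in> V then ?A else {}) \<union> (if 0 \<in> V then topspace X - ?A else {})"
    by (auto simp: indicator_def)
  then show "openin X {x \<in> topspace X. indicator A x \<in> V}"
    using assms by auto
qed simp

lemma kappa_sequential_if_image_of_sR_space:
  assumes "Hausdorff_space Y" "sR_space Y" "weakly_kappa_pseudo_open_map Y X f"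
  shows "kappa_sequential_space X"
  unfolding kappa_sequential_space_def
proof (intro allI impI, rule ccontr)
  fix W
  assume W: "openin X W \<and> \<not> closedin X W"
    and no: "\<not> (\<exists>z\<in>X closure_of W - W. \<exists>s. range s \<subseteq> W \<and> limitin X s z sequentially)"
  \<comment> \<open>A limit of a sequence in \<open>W\<close> lies in the closure of
    \<open>W\<close>, so by \<open>no\<close> it cannot lie outside \<open>W\<close>.\<close>
  have seq: "z \<in> W" if "range s \<subseteq> W" "limitin X s z sequentially" for s z
    using no that openin_subset W by (meson DiffI limitin_sequentially_closure_of)
  define A where "A = {y \<in> topspace Y. f y \<in> W}"
  have f: "continuous_map Y X f"
    using assms(3) by (simp add: weakly_kappa_pseudo_open_map_def)
  have oA: "openin Y A"
    using f W unfolding A_def by (simp add: openin_continuous_map_preimage)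
  have "continuous_map (subtopology Y S) euclideanreal (indicator A)" if S: "S \<in> convergent_seqs Y" for S
  proof (rule continuous_map_indicator_clopen)
    let ?B = "{y \<in> topspace (subtopology Y S). y \<in> A}"
    have B: "?B = A \<inter> S"
      by (auto simp: A_def)
    show "openin (subtopology Y S) ?B"
      unfolding B using oA by (simp add: openin_subtopology_Int)
    \<comment> \<open>Since \<open>Y\<close> is Hausdorff, \<open>S\<close> is metrizable, so
      closedness of the trace can be tested by sequences. The map \<open>f\<close> carries these to
      sequences in \<open>W\<close>, whose limits stay in \<open>W\<close> by
      \<open>seq\<close>.\<close>
    have "sequential_space (subtopology Y S)"
      by (simp add: S assms(1) metrizable_imp_sequential_space metrizable_space_convergent_seq)
    moreover have "z \<in> ?B" if z: "range s \<subseteq> ?B" "limitin (subtopology Y S) s z sequentially" for s z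
    proof -
      have "limitin Y s z sequentially" "z \<in> S"
        using z(2) by (auto simp: limitin_subtopology)
      then have "limitin X (f \<circ> s) (f z) sequentially" "z \<in> topspace Y"
        using continuous_map_limit[OF f] by (simp_all add: limitin_def)
      moreover from this have "f z \<in> W"
        using z(1) by (intro seq[of "f \<circ> s"]) (auto simp: A_def)
      ultimately show ?thesis
        using \<open>z \<in> S\<close> by (auto simp: A_def)
    qed
    ultimately show "closedin (subtopology Y S) ?B"
      unfolding sequential_space_def by (metis (no_types, lifting) DiffE mem_Collect_eq subsetI)
  qed
  then have "continuous_map Y euclideanreal (indicator A)"
    using assms(2) unfolding sR_space_def sequentially_continuous_real_def by blast
  \<comment> \<open>As the preimage of the closed set \<open>{1}\<close>, \<open>A\<close> is
    closed; weak kappa-pseudo-openness then makes the open set \<open>W\<close> closed, contrary to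
    its choice.\<close>
  then have "closedin Y {y \<in> topspace Y. (indicator A y :: real) \<in> {1}}"
    by (rule closedin_continuous_map_preimage) simp
  moreover have "{y \<in> topspace Y. (indicator A y :: real) \<in> {1}} = A"
    by (auto simp: A_def indicator_def)
  ultimately show False
    using W assms(3) unfolding weakly_kappa_pseudo_open_map_def A_def by metis
qed

section \<open>The natural map from the sum of all convergent sequences\<close>

lemma convergent_seqs_subset_topspace:
  "S \<in> convergent_seqs X \<Longrightarrow> S \<subseteq> topspace X"
  by (auto simp: convergent_seqs_def limitin_def)

text \<open>A non-closed open \<open>U\<close> contains a sequence whose limit is outside
  \<open>U\<close>. This sequence with its limit is itself a summand, and there the preimage of
  \<open>U\<close> misses the limit, so it is not closed. The other direction is continuity.\<close>

lemma snd_weakly_kappa_pseudo_open: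
  assumes "kappa_sequential_space X"
  shows "weakly_kappa_pseudo_open_map (convergent_seqs_sum X) X snd"
proof -
  let ?Y = "convergent_seqs_sum X"
  have top: "topspace ?Y = (SIGMA S:convergent_seqs X. S)"
    using convergent_seqs_subset_topspace by (fastforce simp: convergent_seqs_sum_def)
  have cont: "continuous_map ?Y X snd"
    unfolding continuous_map_def
  proof (intro conjI allI impI)
    show "snd \<in> topspace ?Y \<rightarrow> topspace X"
      using convergent_seqs_subset_topspace by (fastforce simp: top)
    fix U
    assume U: "openin X U"
    have "{x. (S, x) \<in> {p \<in> topspace ?Y. snd p \<in> U}} = U \<inter> S" if "S \<in> convergent_seqs X" for S
      using that by (auto simp: top)
    with U show "openin ?Y {p \<in> topspace ?Y. snd p \<in> U}"
      using openin_subset by (auto simp: convergent_seqs_sum_def openin_sum_topology openin_subtopology_Int)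
  qed
  \<comment> \<open>Constant sequences make the map surjective.\<close>
  have "{x} \<in> convergent_seqs X" if "x \<in> topspace X" for x
    unfolding convergent_seqs_def using that
    by (auto intro!: exI[of _ "\<lambda>_::nat. x"] exI[of _ x])
  then have surj: "snd ` topspace ?Y = topspace X"
    using convergent_seqs_subset_topspace by (force simp: top)
  have "closedin X U" if U: "openin X U" and clo: "closedin ?Y {p \<in> topspace ?Y. snd p \<in> U}" for U
  proof (rule ccontr)
    assume "\<not> closedin X U"
    then obtain z s where z: "z \<notin> U" and s: "range s \<subseteq> U" "limitin X s z sequentially"
      using assms U unfolding kappa_sequential_space_def by blast
    let ?S = "insert z (range s)"
    have S: "?S \<in> convergent_seqs X"
      using s openin_subset[OF U] unfolding convergent_seqs_def by blast
    then have "closedin (subtopology X ?S) {x. (?S, x) \<in> {p \<in> topspace ?Y. snd p \<in> U}}"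
      using clo unfolding convergent_seqs_sum_def closedin_sum_topology by blast
    \<comment> \<open>The slice is exactly the sequence without its limit, because \<open>s\<close>
      runs inside \<open>U\<close> and \<open>z\<close> is outside.\<close>
    moreover have "{x. (?S, x) \<in> {p \<in> topspace ?Y. snd p \<in> U}} = range s"
      using S z s(1) by (auto simp: top)
    ultimately have "closedin (subtopology X ?S) (range s)"
      by simp
    moreover have "limitin (subtopology X ?S) s z sequentially"
      using s(2) by (simp add: limitin_subtopology)
    ultimately have "z \<in> range s"
      using limitin_closedin by (metis (mono_tags, lifting) always_eventually rangeI trivial_limit_sequentially)
    then show False
      using z s(1) by blast
  qed
  then show ?thesis
    unfolding weakly_kappa_pseudo_open_map_def
    by (intro conjI allI impI iffI cont surj closedin_continuous_map_preimage[OF cont])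
qed

lemma metrizable_space_convergent_seqs_sum:
  "Hausdorff_space X \<Longrightarrow> metrizable_space (convergent_seqs_sum X)"
  by (simp add: convergent_seqs_sum_def metrizable_space_sum_topology metrizable_space_convergent_seq)

lemma locally_compact_space_convergent_seqs_sum:
  "locally_compact_space (convergent_seqs_sum X)"
  by (simp add: convergent_seqs_sum_def locally_compact_space_sum_topology
      compact_imp_locally_compact_space compact_space_convergent_seq)

section \<open>Equivalence of the five conditions\<close>

text \<open>A formula cannot quantify over types. Existence is therefore asserted over the point
  type \<open>'a set \<times> 'a\<close>, where the sum of the convergent sequences lives, and the
  implications back to kappa-sequentiality are stated again for spaces \<open>Y\<close> over an
  arbitrary type \<open>'b\<close>.\<close>

theorem theorem5p3:
  fixes X :: "'a topology"
  assumes "tychonoff_space X"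
  shows
    "(kappa_sequential_space X \<longleftrightarrow>
        weakly_kappa_pseudo_open_map (convergent_seqs_sum X) X snd) \<and>
     (kappa_sequential_space X \<longleftrightarrow>
        (\<exists>(Y :: ('a set \<times> 'a) topology) f. tychonoff_space Y \<and>
           metrizable_space Y \<and> locally_compact_space Y \<and>
           weakly_kappa_pseudo_open_map Y X f)) \<and>
     (kappa_sequential_space X \<longleftrightarrow>
        (\<exists>(Y :: ('a set \<times> 'a) topology) f. tychonoff_space Y \<and>
           sequential_space Y \<and> weakly_kappa_pseudo_open_map Y X f)) \<and>
     (kappa_sequential_space X \<longleftrightarrow>
        (\<exists>(Y :: ('a set \<times> 'a) topology) f. tychonoff_space Y \<and>
           sR_space Y \<and> weakly_kappa_pseudo_open_map Y X f)) \<and>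
     ((\<exists>(Y :: 'b topology) f. tychonoff_space Y \<and>
           metrizable_space Y \<and> locally_compact_space Y \<and>
           weakly_kappa_pseudo_open_map Y X f) \<longrightarrow> kappa_sequential_space X) \<and>
     ((\<exists>(Y :: 'b topology) f. tychonoff_space Y \<and>
           sequential_space Y \<and> weakly_kappa_pseudo_open_map Y X f) \<longrightarrow>
        kappa_sequential_space X) \<and>
     ((\<exists>(Y :: 'b topology) f. tychonoff_space Y \<and>
           sR_space Y \<and> weakly_kappa_pseudo_open_map Y X f) \<longrightarrow>
        kappa_sequential_space X)"
proof -
  have Haus: "Hausdorff_space X"
    using assms by (simp add: tychonoff_space_def)
  let ?Y = "convergent_seqs_sum X"
  \<comment> \<open>The same space, with the map \<open>snd\<close>, witnesses all the existence
    claims.\<close>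
  have Y: "tychonoff_space ?Y" "metrizable_space ?Y" "locally_compact_space ?Y"
      "sequential_space ?Y" "sR_space ?Y"
    using metrizable_space_convergent_seqs_sum[OF Haus]
    by (simp_all add: metrizable_imp_tychonoff_space locally_compact_space_convergent_seqs_sum
        metrizable_imp_sequential_space sequential_imp_sR_space)
  \<comment> \<open>Metrizable spaces are sequential and sequential spaces are s_R-spaces, so one
    lemma covers all kinds of domain. The type \<open>'z\<close> is arbitrary, so that the fact
    serves both point types of the statement.\<close>
  have image: "kappa_sequential_space X"
    if "tychonoff_space Z" "metrizable_space Z \<or> sequential_space Z \<or> sR_space Z"
      "weakly_kappa_pseudo_open_map Z X f" for Z :: "'z topology" and f
    using that kappa_sequential_if_image_of_sR_space metrizable_imp_sequential_space
      sequential_imp_sR_space unfolding tychonoff_space_def by blast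
  show ?thesis
    by (intro conjI iffI impI) (use Y snd_weakly_kappa_pseudo_open[of X] image in blast)+
qed

end
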